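(* For every positive integer $n$, $$\sum_{k=0}^{n-1}(3k+2)(-1)^k f_k \equiv 0 \pmod{2n^2},$$ where $f_k=\sum_{j=0}^{k}\binom{k}{j}^3$ is the $k$-th Franel number.
   Context: The Franel numbers are defined for all nonnegative integers $k$ by $f_k=\sum_{j=0}^{k}\binom{k}{j}^3$. *)

theory Defs
  imports "HOL-Number_Theory.Cong"
begin

definition franel :: "nat \<Rightarrow> nat" where
  "franel k = (\<Sum>j=0..k. (k choose j) ^ 3)"

end

theory Submission
  imports Defs "HOL-Computational_Algebra.Polynomial"
begin

text \<open>
  Write \<open>f\<^sub>j\<close> as the sum over \<open>k\<close> of \<open>C(j+k,k) C(j,2k) C(2k,k) 2\<^bsup>j-2k\<^esup>\<close>, a special case of
  MacMahon's identity. For fixed \<open>k\<close>, the alternating sum of \<open>3j+2\<close> times this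
  summand over \<open>j \<le> m\<close> telescopes to \<open>\<plusminus>2(m+1) C(m+1+k,k) C(m,2k) C(2k,k) 2\<^bsup>m-2k\<^esup>\<close>. Expanding
  \<open>C(m+1+k,k)\<close> by Vandermonde and summing over \<open>k\<close> leaves
  \<open>\<plusminus>2(m+1)\<close> times the sum over \<open>i\<close> of \<open>C(m+1,i) C(m,i) C(2m-2i,m)\<close>, in which every term is
  divisible by \<open>m+1\<close>: absorption shows that \<open>m+1\<close> divides both \<open>i X\<close> and \<open>(2m-2i+1) X\<close>
  for \<open>X = C(m+1,i) C(2m-2i,m)\<close>.
\<close>

section \<open>Vandermonde and trinomial coefficient sums\<close>

lemma coeff_one_linear_power: "coeff ([:1, b:] ^ n) i = of_nat (n choose i) * b ^ i"
  for b :: "'a :: comm_semiring_1"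
proof (cases "i \<le> n")
  case False
  have "degree ([:1, b:] ^ n) \<le> n"
    using degree_power_le[of "[:1, b:]" n] by (auto split: if_splits)
  then show ?thesis
    using False by (simp add: coeff_eq_0 binomial_eq_0)
qed (simp add: coeff_linear_poly_power)

text \<open>Vandermonde's convolution with C(k,k-i) read as C(k,i). The upper limit \<open>n\<close>
  in place of \<open>k\<close> adds only zero terms and makes the range independent of
  \<open>k\<close>, so that double sums can be swapped.\<close>

lemma choose_add_eq_sum:
  assumes "k \<le> n"
  shows "a + k choose k = (\<Sum>i\<le>n. (a choose i) * (k choose i))"
proof -
  have "a + k choose k = (\<Sum>i\<le>k. (a choose i) * (k choose i))"
    unfolding vandermonde[symmetric] by (intro sum.cong) (auto simp: binomial_symmetric[symmetric])
  also have "\<dots> = (\<Sum>i\<le>n. (a choose i) * (k choose i))"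
    using assms by (intro sum.mono_neutral_left) auto
  finally show ?thesis .
qed

lemma sum_trinomial_powers_of_2:
  "(\<Sum>p\<le>r. if 2 * p \<le> s then (r choose p) * (r - p choose (s - 2 * p)) * 2 ^ (s - 2 * p) else 0)
     = 2 * r choose s"
proof -
  \<comment> \<open>compare the coefficients of \<open>x\<^sup>s\<close> in \<open>(1 + x)\<^bsup>2r\<^esup> = (x\<^sup>2 + (1 + 2x))\<^sup>r\<close>\<close>
  have "[:1, 1:] ^ (2 * r) = (monom 1 2 + [:1, 2:] :: nat poly) ^ r"
    by (simp add: power_mult power2_eq_square monom_altdef)
  also have "\<dots> = (\<Sum>p\<le>r. of_nat (r choose p) * monom 1 2 ^ p * [:1, 2:] ^ (r - p))"
    by (rule binomial_ring)
  also have "\<dots> = (\<Sum>p\<le>r. monom (r choose p) (2 * p) * [:1, 2:] ^ (r - p))"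
    by (simp add: monom_power of_nat_poly smult_monom mult.commute)
  finally have "coeff ([:1, 1:] ^ (2 * r)) s
    = coeff (\<Sum>p\<le>r. monom (r choose p) (2 * p) * [:1, 2:] ^ (r - p)) s"
    by simp
  then have "2 * r choose s
    = (\<Sum>p\<le>r. coeff (monom (r choose p) (2 * p) * [:1, 2:] ^ (r - p)) s)"
    by (simp only: coeff_one_linear_power coeff_sum) simp
  then show ?thesis
    by (auto simp: coeff_monom_mult coeff_one_linear_power simp del: One_nat_def intro!: sum.cong)
qed

text \<open>Both sides are n! / (i! m! (i+m)! (n-2i-2m)!); the assumption makes every subtraction
  exact.\<close>

lemma binomial_product_rearrange:
  assumes "2 * i + 2 * m \<le> n"
  shows "(i + m choose i) * (2 * (i + m) choose (i + m)) * (n choose (2 * (i + m)))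
       = (n choose i) * (n - i choose m) * (n - i - m choose (n - 2 * i - 2 * m))"
    (is "?l = ?r")
proof -
  have "2 * (i + m) - (i + m) = i + m" "n - i - m - (n - 2 * i - 2 * m) = i + m"
    "n - 2 * (i + m) = n - 2 * i - 2 * m"
    using assms by auto
  then have "of_nat ?l = (of_nat ?r :: rat)"
    using assms by (simp add: binomial_fact)
  then show ?thesis
    by (simp only: of_nat_eq_iff)
qed

text \<open>Substituting k = i+m and rearranging pulls out C(n,i); what remains is the coefficient
  sum for r = n-i and s = n-2i, with value C(2n-2i,n-2i) = C(2n-2i,n).\<close>

lemma sum_choose_central_trinomial:
  "(\<Sum>k\<le>n. (k choose i) * (2 * k choose k) * (n choose (2 * k)) * 2 ^ (n - 2 * k))
     = (n choose i) * (2 * n - 2 * i choose n)" (is "?S = _")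
proof (cases "2 * i \<le> n")
  case False
  \<comment> \<open>A nonzero term would need i <= k and 2k <= n, hence 2i <= n.\<close>
  have "(k choose i) * (2 * k choose k) * (n choose (2 * k)) * 2 ^ (n - 2 * k) = 0" for k
    using False by (cases "k < i") auto
  moreover have "(n choose i) * (2 * n - 2 * i choose n) = 0"
    using False by (cases "n < i") auto
  ultimately show ?thesis
    by (simp only: sum.neutral_const)
next
  case True
  let ?g = "\<lambda>k. (k choose i) * (2 * k choose k) * (n choose (2 * k)) * 2 ^ (n - 2 * k)"
  have "?S = (\<Sum>k=i..n. ?g k)"
    by (intro sum.mono_neutral_right) auto
  also have "\<dots> = (\<Sum>m\<le>n - i. ?g (i + m))"
    using True by (intro sum.reindex_bij_witness[of _ "\<lambda>m. i + m" "\<lambda>k. k - i"]) auto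
  also have "\<dots> = (\<Sum>m\<le>n - i. (n choose i) * (if 2 * m \<le> n - 2 * i
      then (n - i choose m) * (n - i - m choose (n - 2 * i - 2 * m)) * 2 ^ (n - 2 * i - 2 * m)
      else 0))"
  proof (intro sum.cong refl)
    fix m
    show "?g (i + m) = (n choose i) * (if 2 * m \<le> n - 2 * i
      then (n - i choose m) * (n - i - m choose (n - 2 * i - 2 * m)) * 2 ^ (n - 2 * i - 2 * m)
      else 0)"
    proof (cases "2 * m \<le> n - 2 * i")
      case le: True
      then have *: "2 * i + 2 * m \<le> n" "n - 2 * (i + m) = n - 2 * i - 2 * m"
        using True by auto
      show ?thesis
        unfolding binomial_product_rearrange[OF *(1)] *(2) using le by (simp only: if_True mult.assoc)
    qed (use True in auto)
  qed
  also have "\<dots> = (n choose i) * (2 * (n - i) choose (n - 2 * i))"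
    by (simp only: sum_distrib_left[symmetric] sum_trinomial_powers_of_2)
  also have "2 * (n - i) choose (n - 2 * i) = 2 * n - 2 * i choose n"
    using True binomial_symmetric[of n "2 * n - 2 * i"] by (simp add: diff_mult_distrib2)
  finally show ?thesis .
qed

text \<open>The parameter \<open>a\<close> stays free because two values are needed: a = n yields
  the Franel numbers, a = n+1 the sum left after telescoping.\<close>

lemma sum_choose_add_central_trinomial:
  "(\<Sum>k\<le>n. (a + k choose k) * (n choose (2 * k)) * (2 * k choose k) * 2 ^ (n - 2 * k))
     = (\<Sum>i\<le>n. (a choose i) * (n choose i) * (2 * n - 2 * i choose n))" (is "?S = _")
proof -
  have "?S = (\<Sum>k\<le>n. \<Sum>i\<le>n. (a choose i) *
      ((k choose i) * (2 * k choose k) * (n choose (2 * k)) * 2 ^ (n - 2 * k)))"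
    by (intro sum.cong refl) (simp add: choose_add_eq_sum[of _ n] sum_distrib_left sum_distrib_right mult_ac)
  also have "\<dots> = (\<Sum>i\<le>n. \<Sum>k\<le>n. (a choose i) *
      ((k choose i) * (2 * k choose k) * (n choose (2 * k)) * 2 ^ (n - 2 * k)))"
    by (rule sum.swap)
  also have "\<dots> = (\<Sum>i\<le>n. (a choose i) * ((n choose i) * (2 * n - 2 * i choose n)))"
    by (simp only: sum_distrib_left[symmetric] sum_choose_central_trinomial)
  finally show ?thesis
    by (simp only: mult.assoc)
qed

section \<open>Franel numbers as single sums\<close>

lemma franel_eq_sum_squares:
  "franel n = (\<Sum>i\<le>n. (n choose i) * (n choose i) * (2 * n - 2 * i choose n))"
proof -
  \<comment> \<open>When no factor vanishes, both sides are n!^2 / ((n-j)!^2 l! (n-l)! (j-l)!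
    (j+l-n)!). The right side depends on \<open>j\<close> only through a Vandermonde product, so the
    sum over \<open>j\<close> can be evaluated.\<close>
  have term_eq: "(n choose j) * (n choose j) * ((j choose l) * (j choose (n - l)))
      = (n choose l) * (n choose l) * ((l choose (n - j)) * (n - l choose (n - j)))"
    (is "?l = ?r") if "l \<le> n" "j \<le> n" for j l
  proof (cases "l \<le> j \<and> n - l \<le> j")
    case True
    then have le: "n - j \<le> l" "n - j \<le> n - l"
      and diff: "j - (n - l) = l - (n - j)" "n - l - (n - j) = j - l"
      using that by auto
    have "of_nat ?l = (of_nat ?r :: rat)"
      using that True
      by (simp add: binomial_fact binomial_fact[OF le(1)] binomial_fact[OF le(2)] diff del: diff_diff_left)
    then show ?thesis
      by (simp only: of_nat_eq_iff)
  next
    case False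
    then have "j < l \<or> j < n - l" "n - l < n - j \<or> l < n - j"
      using that by linarith+
    then have "(j choose l) * (j choose (n - l)) = 0" "(l choose (n - j)) * (n - l choose (n - j)) = 0"
      by auto
    then show ?thesis
      by (simp only: mult_0_right)
  qed
  have "(\<Sum>i\<le>n. (n choose i) * (n choose i) * (2 * n - 2 * i choose n))
      = (\<Sum>j\<le>n. (n choose j) * (n choose j) * (j + j choose n))"
    by (intro sum.reindex_bij_witness[of _ "\<lambda>j. n - j" "\<lambda>j. n - j"])
      (auto simp: binomial_symmetric[symmetric] diff_mult_distrib2 mult_2)
  also have "\<dots> = (\<Sum>j\<le>n. \<Sum>l\<le>n. (n choose j) * (n choose j) * ((j choose l) * (j choose (n - l))))"
    by (simp only: vandermonde[symmetric] sum_distrib_left)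
  also have "\<dots> = (\<Sum>l\<le>n. \<Sum>j\<le>n. (n choose j) * (n choose j) * ((j choose l) * (j choose (n - l))))"
    by (rule sum.swap)
  also have "\<dots> = (\<Sum>l\<le>n. (n choose l) ^ 3)"
  proof (intro sum.cong refl)
    fix l assume "l \<in> {..n}"
    then have l: "l \<le> n" by simp
    have "(\<Sum>j\<le>n. (n choose j) * (n choose j) * ((j choose l) * (j choose (n - l))))
        = (\<Sum>j\<le>n. (n choose l) * (n choose l) *
            ((l choose (n - j)) * (n - l choose (n - j))))"
      using l by (intro sum.cong refl term_eq) auto
    also have "\<dots> = (n choose l) * (n choose l) *
        (\<Sum>j\<le>n. (l choose (n - j)) * (n - l choose (n - j)))"
      by (simp only: sum_distrib_left)
    also have "(\<Sum>j\<le>n. (l choose (n - j)) * (n - l choose (n - j)))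
        = (\<Sum>j\<le>n. (l choose j) * (n - l choose j))"
      by (intro sum.reindex_bij_witness[of _ "\<lambda>j. n - j" "\<lambda>j. n - j"]) auto
    also have "\<dots> = n choose (n - l)"
      using choose_add_eq_sum[of "n - l" n l] l by simp
    also have "\<dots> = n choose l"
      using l by (rule binomial_symmetric[symmetric])
    finally show "(\<Sum>j\<le>n. (n choose j) * (n choose j) * ((j choose l) * (j choose (n - l))))
        = (n choose l) ^ 3"
      by (simp add: power3_eq_cube)
  qed
  finally show ?thesis
    by (simp add: franel_def atMost_atLeast0)
qed

lemma franel_eq_sum_central_trinomial:
  "franel n = (\<Sum>k\<le>n. (n + k choose k) * (n choose (2 * k)) * (2 * k choose k) * 2 ^ (n - 2 * k))"
  by (simp only: franel_eq_sum_squares sum_choose_add_central_trinomial)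

section \<open>Telescoping the alternating sum\<close>

text \<open>Split 3m+5 = 2(m+2+k) + (m+1-2k). Absorption turns the first part into a shift of
  C(m+1+k,k) to C(m+2+k,k), and the second into a shift of C(m+1,2k) to C(m,2k).\<close>

lemma telescoping_step:
  "(3 * m + 5) * ((m + 1 + k choose k) * (m + 1 choose (2 * k)) * (2 * k choose k) * 2 ^ (m + 1 - 2 * k))
   = 2 * (m + 2) * ((m + 2 + k choose k) * (m + 1 choose (2 * k)) * (2 * k choose k) * 2 ^ (m + 1 - 2 * k))
   + 2 * (m + 1) * ((m + 1 + k choose k) * (m choose (2 * k)) * (2 * k choose k) * 2 ^ (m - 2 * k))"
proof (cases "2 * k \<le> m + 1")
  case True
  define A where "A = m + 1 + k choose k"
  define B where "B = (m + 1 choose (2 * k)) * 2 ^ (m + 1 - 2 * k)"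
  have A: "(m + 2) * (m + 2 + k choose k) = (m + 2 + k) * A"
    using binomial_absorb_comp[of "m + 2 + k" k] by (simp add: A_def)
  have "(m + 1 - 2 * k) * (m + 1 choose (2 * k)) = (m + 1) * (m choose (2 * k))"
    using binomial_absorb_comp[of "m + 1" "2 * k"] by simp
  \<comment> \<open>For 2k = m+1 the exponent m-2k is truncated, but then C(m,2k) = 0.\<close>
  moreover have "2 * (m + 1) * ((m choose (2 * k)) * 2 ^ (m - 2 * k))
      = (m + 1) * (m choose (2 * k)) * 2 ^ (m + 1 - 2 * k)"
    using True by (cases "2 * k = m + 1") (simp_all add: Suc_diff_le algebra_simps)
  ultimately have B: "2 * (m + 1) * ((m choose (2 * k)) * 2 ^ (m - 2 * k)) = (m + 1 - 2 * k) * B"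
    unfolding B_def by (metis mult.assoc)
  have "3 * m + 5 = 2 * (m + 2 + k) + (m + 1 - 2 * k)"
    using True by simp
  then have "(3 * m + 5) * (A * B * (2 * k choose k))
      = 2 * ((m + 2 + k) * A) * B * (2 * k choose k) + A * ((m + 1 - 2 * k) * B) * (2 * k choose k)"
    by (simp only:) (simp only: algebra_simps)
  then show ?thesis
    unfolding A[symmetric] B[symmetric] by (simp only: A_def B_def mult_ac)
next
  case False
  then have "m + 1 choose (2 * k) = 0" "m choose (2 * k) = 0"
    by auto
  then show ?thesis
    by (simp only: mult_0_right mult_0 add_0)
qed

lemma sum_alternating_telescope:
  "(\<Sum>n\<le>m. (3 * int n + 2) * (-1) ^ n *
      int ((n + k choose k) * (n choose (2 * k)) * (2 * k choose k) * 2 ^ (n - 2 * k)))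
   = (-1) ^ m * int (2 * (m + 1) *
      ((m + 1 + k choose k) * (m choose (2 * k)) * (2 * k choose k) * 2 ^ (m - 2 * k)))"
proof (induction m)
  case 0
  show ?case by (cases "k = 0") auto
next
  case (Suc m)
  \<comment> \<open>Here \<open>a\<close> and \<open>b\<close> are the partial sums up to m and m+1
    without sign, and \<open>t\<close> is the new summand; the opposite signs cancel
    \<open>a\<close>.\<close>
  have alternate: "(-1) ^ m * int a + (3 * int (Suc m) + 2) * (-1) ^ Suc m * int t = (-1) ^ Suc m * int b"
    if "(3 * m + 5) * t = b + a" for a b t
  proof -
    have "(3 * int (Suc m) + 2) * int t = int b + int a"
      using arg_cong[OF that, of int] by (simp add: algebra_simps)
    then have "(-1) ^ m * ((3 * int (Suc m) + 2) * int t) = (-1) ^ m * (int b + int a)"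
      by (rule arg_cong)
    then show ?thesis
      by (simp add: algebra_simps)
  qed
  show ?case
    unfolding sum.atMost_Suc Suc.IH
    using telescoping_step[of m k] by (intro alternate) (simp add: numeral_eq_Suc)
qed

section \<open>Divisibility\<close>

lemma dvd_choose_mult_central:
  "m + 1 dvd (m + 1 choose i) * (2 * m - 2 * i choose m)" (is "_ dvd ?X")
proof (cases "2 * i \<le> m")
  case True
  have 1: "m + 1 dvd i * ?X"
  proof (cases i)
    case (Suc j)
    then have "i * ?X = (m + 1) * ((m choose j) * (2 * m - 2 * i choose m))"
      using Suc_times_binomial[of j m] by (simp only: Suc_eq_plus1 mult.assoc[symmetric])
    then show ?thesis by (simp only: dvd_triv_left)
  qed simp
  have "(m + 1) * (2 * m - 2 * i + 1 choose (m + 1))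
      = (2 * m - 2 * i + 1) * (2 * m - 2 * i choose m)"
    using Suc_times_binomial[of m "2 * m - 2 * i"] by (simp only: Suc_eq_plus1)
  then have "m + 1 dvd (2 * m - 2 * i + 1) * ?X"
    by (metis dvd_mult dvd_triv_left mult.left_commute)
  then have 2: "m + 1 dvd (2 * m - 2 * i + 1) * ?X + 2 * (i * ?X)"
    using 1 by (metis dvd_add dvd_mult)
  \<comment> \<open>Since (2m-2i+1) + 2i = 2(m+1) - 1, the two known multiples of m+1 combine to -X
    modulo m+1.\<close>
  have combine: "a * x + 2 * (i * x) + x = (m + 1) * (2 * x)"
    if "a + 2 * i + 1 = 2 * (m + 1)" for a x
    using arg_cong[OF that, of "\<lambda>c. c * x"] by (simp add: algebra_simps)
  have "(2 * m - 2 * i + 1) * ?X + 2 * (i * ?X) + ?X = (m + 1) * (2 * ?X)"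
    using True by (intro combine) simp
  then show ?thesis
    using dvd_add_right_iff[OF 2] by (metis dvd_triv_left)
next
  case False
  \<comment> \<open>For m = 0 truncation gives C(0,0) = 1 rather than 0, but the divisor is then
    1.\<close>
  then have "m = 0 \<or> 2 * m - 2 * i < m"
    by linarith
  then show ?thesis
    by (auto simp: binomial_eq_0)
qed

theorem theorem1p1:
  fixes n :: nat
  assumes "n > 0"
  shows "[(\<Sum>k=0..<n. (3 * int k + 2) * (-1) ^ k * int (franel k)) = 0] (mod (2 * (int n)\<^sup>2))"
proof -
  obtain m where n: "n = m + 1"
    using assms by (metis Suc_eq_plus1 gr0_implies_Suc)
  let ?t = "\<lambda>j k. (j + k choose k) * (j choose (2 * k)) * (2 * k choose k) * 2 ^ (j - 2 * k) :: nat"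
  let ?u = "\<lambda>k. (m + 1 + k choose k) * (m choose (2 * k)) * (2 * k choose k) * 2 ^ (m - 2 * k) :: nat"
  \<comment> \<open>The common bound \<open>m\<close> adds only terms with C(j,2k) = 0 and allows
    the order of summation to be exchanged.\<close>
  have franel: "franel j = (\<Sum>k\<le>m. ?t j k)" if "j \<le> m" for j
    unfolding franel_eq_sum_central_trinomial using that by (intro sum.mono_neutral_left) auto
  have "(\<Sum>j=0..<n. (3 * int j + 2) * (-1) ^ j * int (franel j))
      = (\<Sum>j\<le>m. \<Sum>k\<le>m. (3 * int j + 2) * (-1) ^ j * int (?t j k))"
    unfolding n by (intro sum.cong) (auto simp: franel of_nat_sum sum_distrib_left simp del: of_nat_mult)
  also have "\<dots> = (\<Sum>k\<le>m. \<Sum>j\<le>m. (3 * int j + 2) * (-1) ^ j * int (?t j k))"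
    by (rule sum.swap)
  also have "\<dots> = (\<Sum>k\<le>m. (-1) ^ m * int (2 * (m + 1) * ?u k))"
    by (simp only: sum_alternating_telescope)
  also have "\<dots> = (-1) ^ m * int (2 * (m + 1) * (\<Sum>k\<le>m. ?u k))"
    by (simp only: sum_distrib_left of_nat_sum)
  finally have eq: "(\<Sum>j=0..<n. (3 * int j + 2) * (-1) ^ j * int (franel j))
      = (-1) ^ m * int (2 * (m + 1) * (\<Sum>k\<le>m. ?u k))" .
  have "m + 1 dvd (m + 1 choose i) * (m choose i) * (2 * m - 2 * i choose m)" for i
    using dvd_choose_mult_central[of m i] by (metis dvd_mult mult.assoc mult.left_commute)
  \<comment> \<open>This supplies the second factor n = m+1; the first one, with the 2, comes from
    the telescoped sum.\<close>
  then have "m + 1 dvd (\<Sum>k\<le>m. ?u k)"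
    unfolding sum_choose_add_central_trinomial by (intro dvd_sum)
  then have "2 * n\<^sup>2 dvd 2 * (m + 1) * (\<Sum>k\<le>m. ?u k)"
    by (simp add: n power2_eq_square del: of_nat_mult mult_Suc mult_Suc_right)
  then have "int (2 * n\<^sup>2) dvd int (2 * (m + 1) * (\<Sum>k\<le>m. ?u k))"
    by (simp only: int_dvd_int_iff)
  then have "2 * (int n)\<^sup>2 dvd int (2 * (m + 1) * (\<Sum>k\<le>m. ?u k))"
    by simp
  then show ?thesis
    unfolding eq cong_0_iff by (rule dvd_mult)
qed

end
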